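(* Let $\Gamma$ be a $q$-graph on $V=\mathbb{F}_q^n$ and let $G\leqslant\mathrm{Aut}(\Gamma)$. If $\Gamma$ is a $G$-symmetric $q$-graph, then its classical counterpart $\Gamma_C$ is a $G$-symmetric graph.
   Context: $\Gamma\mathrm{L}_n(q)$ is the group of all invertible semilinear transformations of $\mathbb{F}_q^n$. A $q$-graph on $V=\mathbb{F}_q^n$ is a pair $\Gamma=(\mathcal{V},\mathcal{E})$, where $\mathcal{V}$ is the set of all $1$-dimensional subspaces of $V$ (vertices) and $\mathcal{E}$ is a subset of the set of $2$-dimensional subspaces of $V$ (edges). $\mathrm{Aut}(\Gamma)$ is the setwise stabiliser of $\mathcal{E}$ in $\Gamma\mathrm{L}_n(q)$. For $G\leqslant\mathrm{Aut}(\Gamma)$, the $q$-graph $\Gamma$ is $G$-symmetric if $G$ acts transitively on the set of pairs $(X,Y)\in\mathcal{V}\times\mathcal{V}$ with $\langle X,Y\rangle\in\mathcal{E}$. The classical counterpart of $\Gamma$ is the (classical, simple undirected) graph $\Gamma_C=(\mathcal{V}_C,\mathcal{E}_C)$ with $\mathcal{V}_C=\mathcal{V}$ and $\mathcal{E}_C=\{\{u,v\}\mid u,v\in\mathcal{V},\ \langle u,v\rangle\in\mathcal{E}\}$. A classical graph is $G$-symmetric if $G$ acts on it as a group of automorphisms that is transitive on the set of all ordered pairs of adjacent vertices; here $G$ acts on $\Gamma_C$ via its natural action on $\mathcal{V}$. *)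

theory Defs
  imports "HOL-Analysis.Cartesian_Space" "HOL-Algebra.Group_Action"
begin

text \<open>
  The space \<open>V = F_q^n\<close> is \<open>'k ^ 'n\<close> for a finite field \<open>'k\<close> with \<open>q = CARD('k)\<close> elements
  and \<open>n = CARD('n)\<close>. Subspaces, spans and dimensions over \<open>'k\<close> are those of the
  library interpretation \<open>vec\<close>.
\<close>

definition field_automorphism :: "('k::field \<Rightarrow> 'k) \<Rightarrow> bool" where
  "field_automorphism \<sigma> \<longleftrightarrow> bij \<sigma> \<and> \<sigma> 1 = 1 \<and>
     (\<forall>a b. \<sigma> (a + b) = \<sigma> a + \<sigma> b) \<and> (\<forall>a b. \<sigma> (a * b) = \<sigma> a * \<sigma> b)"

definition semilinear :: "('k::field ^ 'n \<Rightarrow> 'k ^ 'n) \<Rightarrow> bool" where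
  "semilinear f \<longleftrightarrow> (\<forall>x y. f (x + y) = f x + f y) \<and>
     (\<exists>\<sigma>. field_automorphism \<sigma> \<and> (\<forall>a x. f (a *s x) = \<sigma> a *s f x))"

definition GammaL :: "('k::field ^ 'n \<Rightarrow> 'k ^ 'n) monoid" where
  "GammaL = BijGroup UNIV \<lparr>carrier := {f. bij f \<and> semilinear f}\<rparr>"


section \<open>\<open>q\<close>-graphs\<close>

type_synonym ('k, 'n) q_graph = "('k ^ 'n) set set \<times> ('k ^ 'n) set set"

definition q_graph :: "('k::field, 'n::finite) q_graph \<Rightarrow> bool" where
  "q_graph \<Gamma> \<longleftrightarrow>
     fst \<Gamma> = {X. vec.subspace X \<and> vec.dim X = 1} \<and>
     snd \<Gamma> \<subseteq> {W. vec.subspace W \<and> vec.dim W = 2}"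

definition q_Aut :: "('k::field, 'n::finite) q_graph \<Rightarrow> ('k ^ 'n \<Rightarrow> 'k ^ 'n) monoid" where
  "q_Aut \<Gamma> = GammaL \<lparr>carrier := {g \<in> carrier GammaL. (\<lambda>W. g ` W) ` snd \<Gamma> = snd \<Gamma>}\<rparr>"

definition q_arcs ::
  "('k::field, 'n::finite) q_graph \<Rightarrow> (('k ^ 'n) set \<times> ('k ^ 'n) set) set" where
  "q_arcs \<Gamma> = {(X, Y). X \<in> fst \<Gamma> \<and> Y \<in> fst \<Gamma> \<and> vec.span (X \<union> Y) \<in> snd \<Gamma>}"

text \<open>
  Group actions in the library are homomorphisms into \<open>BijGroup E\<close>, whose elements are
  extensional functions; hence the restrictions to \<open>E\<close> below.
\<close>

definition q_symmetric ::
  "('k::field ^ 'n::finite \<Rightarrow> 'k ^ 'n) set \<Rightarrow> ('k, 'n) q_graph \<Rightarrow> bool" where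
  "q_symmetric G \<Gamma> \<longleftrightarrow>
     transitive_action (q_Aut \<Gamma> \<lparr>carrier := G\<rparr>) (q_arcs \<Gamma>)
       (\<lambda>g. \<lambda>(X, Y) \<in> q_arcs \<Gamma>. (g ` X, g ` Y))"


section \<open>Classical graphs\<close>

type_synonym 'v graph = "'v set \<times> 'v set set"

definition simple_graph :: "'v graph \<Rightarrow> bool" where
  "simple_graph \<Delta> \<longleftrightarrow> (\<forall>e \<in> snd \<Delta>. e \<subseteq> fst \<Delta> \<and> card e = 2)"

definition graph_automorphisms :: "'v graph \<Rightarrow> ('v \<Rightarrow> 'v) set" where
  "graph_automorphisms \<Delta> = {f \<in> Bij (fst \<Delta>). (\<lambda>e. f ` e) ` snd \<Delta> = snd \<Delta>}"

definition arcs :: "'v graph \<Rightarrow> ('v \<times> 'v) set" where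
  "arcs \<Delta> = {(u, v). u \<in> fst \<Delta> \<and> v \<in> fst \<Delta> \<and> {u, v} \<in> snd \<Delta>}"

definition symmetric_graph ::
  "('g, 'm) monoid_scheme \<Rightarrow> ('g \<Rightarrow> 'v \<Rightarrow> 'v) \<Rightarrow> 'v graph \<Rightarrow> bool" where
  "symmetric_graph H \<phi> \<Delta> \<longleftrightarrow>
     simple_graph \<Delta> \<and>
     group_action H (fst \<Delta>) \<phi> \<and>
     \<phi> ` carrier H \<subseteq> graph_automorphisms \<Delta> \<and>
     transitive_action H (arcs \<Delta>) (\<lambda>g. \<lambda>(u, v) \<in> arcs \<Delta>. (\<phi> g u, \<phi> g v))"

definition classical_counterpart ::
  "('k::field, 'n::finite) q_graph \<Rightarrow> ('k ^ 'n) set graph" where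
  "classical_counterpart \<Gamma> =
     (fst \<Gamma>, {{u, v} | u v. u \<in> fst \<Gamma> \<and> v \<in> fst \<Gamma> \<and> vec.span (u \<union> v) \<in> snd \<Gamma>})"

end

theory Submission
  imports Defs
begin

text \<open>
  The arcs of the classical counterpart are exactly the arcs of the \<open>q\<close>-graph, so transitivity
  carries over directly. An invertible semilinear map commutes with spans, hence permutes the
  vertices and preserves adjacency. There are no loops because \<open>\<langle>X, X\<rangle> = X\<close> has dimension 1.
\<close>

text \<open>One inclusion is span induction. The other uses minimality of the span: \<open>f\<close>
  vec.span S\<open>is itself a subspace containing\<close>f \<open>S\<close>.\<close>

lemma semilinear_image_span:
  fixes f :: "'k::field ^ 'n::finite \<Rightarrow> 'k ^ 'n"
  assumes "semilinear f"
  shows "f ` vec.span S = vec.span (f ` S)"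
proof
  obtain \<sigma> where \<sigma>: "field_automorphism \<sigma>" and scale: "\<And>a x. f (a *s x) = \<sigma> a *s f x"
    and add: "\<And>x y. f (x + y) = f x + f y"
    using assms by (auto simp: semilinear_def)
  have zero: "f 0 = 0"
    using add[of 0 0] by simp
  \<comment> \<open>Closure of the image under an arbitrary scalar \<open>a\<close> needs
    \<open>a = \<sigma> b\<close>, for then \<open>a *s f x = f (b *s x)\<close>.\<close>
  have surj: "\<exists>b. a = \<sigma> b" for a
    using \<sigma> by (auto simp: field_automorphism_def bij_def)
  have "f x \<in> vec.span (f ` S)" if "x \<in> vec.span S" for x
    using that
    by (induction rule: vec.span_induct_alt)
      (auto simp: zero add scale intro: vec.span_zero vec.span_add vec.span_scale vec.span_base)
  then show "f ` vec.span S \<subseteq> vec.span (f ` S)"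
    by blast
  have "vec.subspace (f ` vec.span S)"
  proof (rule vec.subspaceI)
    show "0 \<in> f ` vec.span S"
      by (metis zero vec.span_zero imageI)
    show "x + y \<in> f ` vec.span S" if "x \<in> f ` vec.span S" "y \<in> f ` vec.span S" for x y
      using that by (auto simp flip: add intro: vec.span_add)
    show "a *s x \<in> f ` vec.span S" if "x \<in> f ` vec.span S" for a x
      using that surj[of a] by (auto simp flip: scale intro: vec.span_scale)
  qed
  then show "vec.span (f ` S) \<subseteq> f ` vec.span S"
    by (intro vec.span_minimal image_mono vec.span_superset)
qed

text \<open>Provides each vertex with a nonzero generator, so that its image under a semilinear map
  can be computed from a single vector.\<close>

lemma line_iff_span:
  fixes X :: "('k::field ^ 'n::finite) set"
  shows "vec.subspace X \<and> vec.dim X = 1 \<longleftrightarrow> (\<exists>x. x \<noteq> 0 \<and> X = vec.span {x})"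
proof
  assume X: "vec.subspace X \<and> vec.dim X = 1"
  obtain B where B: "B \<subseteq> X" "vec.independent B" "X \<subseteq> vec.span B" "card B = vec.dim X"
    using vec.basis_exists by blast
  with X obtain x where "B = {x}"
    by (auto simp: card_1_singleton_iff)
  \<comment> \<open>Independence of \<open>{x}\<close> excludes \<open>x = 0\<close>; a subspace
    lying between a set and its span equals that span.\<close>
  with B X have "x \<noteq> 0" "X = vec.span {x}"
    using vec.span_subspace[of B X] by auto
  then show "\<exists>x. x \<noteq> 0 \<and> X = vec.span {x}"
    by blast
next
  assume "\<exists>x. x \<noteq> 0 \<and> X = vec.span {x}"
  then obtain x where x: "x \<noteq> 0" "X = vec.span {x}"
    by blast
  then have "vec.independent {x}"
    by simp
  then show "vec.subspace X \<and> vec.dim X = 1"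
    using x vec.dim_eq_card_independent[of "{x}"] by simp
qed

text \<open>The line generated by \<open>x\<close> goes to the line generated by \<open>f x\<close>,
  and \<open>f x\<close> vanishes only for \<open>x = 0\<close>. Injectivity is inherited from the
  image map on all sets.\<close>

lemma bij_betw_image_lines:
  fixes f :: "'k::field ^ 'n::finite \<Rightarrow> 'k ^ 'n"
  assumes "bij f" "semilinear f"
  shows "bij_betw ((`) f) {X. vec.subspace X \<and> vec.dim X = 1} {X. vec.subspace X \<and> vec.dim X = 1}"
proof -
  have zero: "f x = 0 \<longleftrightarrow> x = 0" for x
  proof -
    have "f (0 + 0) = f 0 + f 0"
      using assms(2) unfolding semilinear_def by blast
    then have "f 0 = 0"
      by simp
    then show ?thesis
      using assms(1) by (metis bij_pointE)
  qed
  have "(`) f ` {X. \<exists>x. x \<noteq> 0 \<and> X = vec.span {x}} = {X. \<exists>x. x \<noteq> 0 \<and> X = vec.span {x}}"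
  proof (intro equalityI subsetI)
    \<comment> \<open>Surjectivity on lines: a generator of \<open>Y\<close> is pulled back along
      \<open>f\<close>. That lines go to lines is left to the closing
      \<open>fastforce\<close>.\<close>
    fix Y :: "('k ^ 'n) set"
    assume "Y \<in> {X. \<exists>x. x \<noteq> 0 \<and> X = vec.span {x}}"
    then obtain y where y: "y \<noteq> 0" "Y = vec.span {y}"
      by blast
    obtain x where "y = f x"
      using assms(1) by (metis bij_pointE)
    with y have "x \<noteq> 0" "Y = f ` vec.span {x}"
      by (auto simp: zero semilinear_image_span[OF assms(2)])
    then show "Y \<in> (`) f ` {X. \<exists>x. x \<noteq> 0 \<and> X = vec.span {x}}"
      by blast
  qed (use zero semilinear_image_span[OF assms(2)] in fastforce)
  moreover have "inj ((`) f)"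
    using assms(1) by (intro injI) (simp add: bij_is_inj inj_image_eq_iff)
  ultimately show ?thesis
    unfolding bij_betw_def line_iff_span by (blast intro: inj_on_subset)
qed

lemma q_AutD:
  assumes "g \<in> carrier (q_Aut \<Gamma>)"
  shows "bij g" "semilinear g" "(\<lambda>W. g ` W) ` snd \<Gamma> = snd \<Gamma>"
  using assms by (auto simp: q_Aut_def GammaL_def)

text \<open>The product comes from \<open>BijGroup UNIV\<close>, where it is restricted to
  bijections; bijectivity of both factors is what lets it unfold to plain composition.\<close>

lemma mult_q_Aut:
  assumes "g \<in> carrier (q_Aut \<Gamma>)" "h \<in> carrier (q_Aut \<Gamma>)"
  shows "g \<otimes>\<^bsub>q_Aut \<Gamma>\<^esub> h = g \<circ> h"
  using q_AutD(1)[OF assms(1)] q_AutD(1)[OF assms(2)]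
  by (auto simp: q_Aut_def GammaL_def BijGroup_def Bij_def compose_def fun_eq_iff)

text \<open>Since \<open>g\<close> commutes with spans, the left-hand span is the
  \<open>g\<close>-image of the right-hand one. Edges are reflected as well as preserved because
  taking images under the injective \<open>g\<close> is injective on sets.\<close>

lemma q_Aut_edge_iff:
  assumes "g \<in> carrier (q_Aut \<Gamma>)"
  shows "vec.span (g ` X \<union> g ` Y) \<in> snd \<Gamma> \<longleftrightarrow> vec.span (X \<union> Y) \<in> snd \<Gamma>"
proof -
  have "vec.span (g ` X \<union> g ` Y) = g ` vec.span (X \<union> Y)"
    by (simp add: semilinear_image_span[OF q_AutD(2)[OF assms]] image_Un)
  moreover have "g ` W \<in> (\<lambda>W. g ` W) ` snd \<Gamma> \<longleftrightarrow> W \<in> snd \<Gamma>" for W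
    using q_AutD(1)[OF assms] by (auto simp: bij_is_inj inj_image_eq_iff)
  ultimately show ?thesis
    using q_AutD(3)[OF assms] by simp
qed

lemma q_graph_vertex_action:
  assumes "q_graph \<Gamma>" "g \<in> carrier (q_Aut \<Gamma>)"
  shows "bij_betw ((`) g) (fst \<Gamma>) (fst \<Gamma>)"
  using bij_betw_image_lines[OF q_AutD(1,2)[OF assms(2)]] assms(1) by (simp add: q_graph_def)

lemma group_action_vertices:
  assumes "q_graph \<Gamma>" "G \<subseteq> carrier (q_Aut \<Gamma>)" "group (q_Aut \<Gamma> \<lparr>carrier := G\<rparr>)"
  shows "group_action (q_Aut \<Gamma> \<lparr>carrier := G\<rparr>) (fst \<Gamma>) (\<lambda>g. \<lambda>X \<in> fst \<Gamma>. g ` X)"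
proof -
  have bij: "(\<lambda>X \<in> fst \<Gamma>. g ` X) \<in> Bij (fst \<Gamma>)" if "g \<in> G" for g
    using q_graph_vertex_action[OF assms(1), of g] assms(2) that
    by (auto simp: Bij_def cong: bij_betw_cong)
  have "(\<lambda>X \<in> fst \<Gamma>. (g \<otimes>\<^bsub>q_Aut \<Gamma>\<^esub> h) ` X)
      = compose (fst \<Gamma>) (\<lambda>X \<in> fst \<Gamma>. g ` X) (\<lambda>X \<in> fst \<Gamma>. h ` X)" if "g \<in> G" "h \<in> G" for g h
  proof
    fix X
    have "h ` X \<in> fst \<Gamma>" if "X \<in> fst \<Gamma>"
      using q_graph_vertex_action[OF assms(1), of h] assms(2) \<open>h \<in> G\<close> that
      by (auto dest: bij_betwE)
    then show "(\<lambda>X \<in> fst \<Gamma>. (g \<otimes>\<^bsub>q_Aut \<Gamma>\<^esub> h) ` X) X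
        = compose (fst \<Gamma>) (\<lambda>X \<in> fst \<Gamma>. g ` X) (\<lambda>X \<in> fst \<Gamma>. h ` X) X"
      using that assms(2) by (auto simp: compose_def mult_q_Aut subset_iff image_comp)
  qed
  with bij show ?thesis
    using assms(3) group_BijGroup
    by (auto simp: group_action_def group_hom_def group_hom_axioms_def hom_def BijGroup_def)
qed

text \<open>The pair \<open>{u, v}\<close> fixes its two members only up to exchange, which is
  harmless as \<open>u \<union> v\<close> is symmetric.\<close>

lemma classical_adjacent_iff:
  assumes "u \<in> fst \<Gamma>" "v \<in> fst \<Gamma>"
  shows "{u, v} \<in> snd (classical_counterpart \<Gamma>) \<longleftrightarrow> vec.span (u \<union> v) \<in> snd \<Gamma>"
  using assms by (auto simp: classical_counterpart_def doubleton_eq_iff Un_commute)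

lemma arcs_classical_counterpart: "arcs (classical_counterpart \<Gamma>) = q_arcs \<Gamma>"
proof -
  have "fst (classical_counterpart \<Gamma>) = fst \<Gamma>"
    by (simp add: classical_counterpart_def)
  then show ?thesis
    by (auto simp: arcs_def q_arcs_def classical_adjacent_iff)
qed

lemma simple_graph_classical_counterpart:
  assumes "q_graph \<Gamma>"
  shows "simple_graph (classical_counterpart \<Gamma>)"
proof -
  have "u \<noteq> v" if "u \<in> fst \<Gamma>" "vec.span (u \<union> v) \<in> snd \<Gamma>" for u v
  proof
    assume "u = v"
    \<comment> \<open>A loop at \<open>u\<close> would make \<open>vec.span u\<close> an edge, and
      passing to the span does not change the dimension.\<close>
    with that assms have "vec.dim u = 1" "vec.dim u = 2"
      by (auto simp: q_graph_def)
    then show False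
      by simp
  qed
  then show ?thesis
    by (fastforce simp: simple_graph_def classical_counterpart_def)
qed

lemma graph_automorphism_classical_counterpart:
  assumes "q_graph \<Gamma>" "g \<in> carrier (q_Aut \<Gamma>)"
  shows "(\<lambda>X \<in> fst \<Gamma>. g ` X) \<in> graph_automorphisms (classical_counterpart \<Gamma>)"
proof -
  let ?f = "\<lambda>X \<in> fst \<Gamma>. g ` X" and ?E = "snd (classical_counterpart \<Gamma>)"
  have bij: "bij_betw ((`) g) (fst \<Gamma>) (fst \<Gamma>)"
    using assms by (rule q_graph_vertex_action)
  have E: "?E = {{u, v} | u v. u \<in> fst \<Gamma> \<and> v \<in> fst \<Gamma> \<and> vec.span (u \<union> v) \<in> snd \<Gamma>}"
    by (simp add: classical_counterpart_def)
  have "(\<lambda>e. ?f ` e) ` ?E = ?E"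
  proof (intro equalityI subsetI)
    fix e assume "e \<in> (\<lambda>e. ?f ` e) ` ?E"
    then obtain u v where "u \<in> fst \<Gamma>" "v \<in> fst \<Gamma>" "vec.span (u \<union> v) \<in> snd \<Gamma>" "e = {g ` u, g ` v}"
      unfolding E by auto
    then show "e \<in> ?E"
      using q_Aut_edge_iff[OF assms(2)] bij_betwE[OF bij] unfolding E by blast
  next
    fix e assume "e \<in> ?E"
    then obtain u v where uv: "u \<in> fst \<Gamma>" "v \<in> fst \<Gamma>" "vec.span (u \<union> v) \<in> snd \<Gamma>" "e = {u, v}"
      unfolding E by auto
    have surj: "\<exists>X' \<in> fst \<Gamma>. X = g ` X'" if "X \<in> fst \<Gamma>" for X
      using bij_betw_imp_surj_on[OF bij] that by (metis imageE)
    \<comment> \<open>The endpoints are pulled back separately, as \<open>g\<close> permutes the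
      vertices; the preimages are adjacent because \<open>g\<close> reflects edges.\<close>
    obtain u' v' where u'v': "u' \<in> fst \<Gamma>" "v' \<in> fst \<Gamma>" "u = g ` u'" "v = g ` v'"
      using surj[OF uv(1)] surj[OF uv(2)] by auto
    with uv have "{u', v'} \<in> ?E"
      by (simp add: classical_adjacent_iff q_Aut_edge_iff[OF assms(2)])
    moreover have "e = ?f ` {u', v'}"
      using uv u'v' by simp
    ultimately show "e \<in> (\<lambda>e. ?f ` e) ` ?E"
      by blast
  qed
  moreover have "?f \<in> Bij (fst \<Gamma>)"
    using bij by (auto simp: Bij_def cong: bij_betw_cong)
  ultimately show ?thesis
    by (simp add: graph_automorphisms_def classical_counterpart_def)
qed

theorem corollary1p4:
  fixes \<Gamma> :: "('k::{field,finite}, 'n::finite) q_graph"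
    and G :: "('k ^ 'n \<Rightarrow> 'k ^ 'n) set"
  assumes "q_graph \<Gamma>"
    and "subgroup G (q_Aut \<Gamma>)"
    and "q_symmetric G \<Gamma>"
  shows "symmetric_graph (q_Aut \<Gamma> \<lparr>carrier := G\<rparr>)
           (\<lambda>g. \<lambda>X \<in> fst \<Gamma>. g ` X) (classical_counterpart \<Gamma>)"
proof -
  let ?H = "q_Aut \<Gamma> \<lparr>carrier := G\<rparr>"
  have trans: "transitive_action ?H (q_arcs \<Gamma>) (\<lambda>g. \<lambda>(X, Y) \<in> q_arcs \<Gamma>. (g ` X, g ` Y))"
    using assms(3) by (simp add: q_symmetric_def)
  \<comment> \<open>An action is a homomorphism from a group, so the group axioms for
    \<open>?H\<close> are part of \<open>trans\<close>.\<close>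
  then have "group ?H"
    by (simp add: transitive_action_def group_action_def group_hom_def)
  moreover have sub: "G \<subseteq> carrier (q_Aut \<Gamma>)"
    using assms(2) by (rule subgroup.subset)
  ultimately have "group_action ?H (fst \<Gamma>) (\<lambda>g. \<lambda>X \<in> fst \<Gamma>. g ` X)"
    using assms(1) by (intro group_action_vertices)
  moreover have "transitive_action ?H (q_arcs \<Gamma>)
      (\<lambda>g. \<lambda>(u, v) \<in> q_arcs \<Gamma>. ((\<lambda>X \<in> fst \<Gamma>. g ` X) u, (\<lambda>X \<in> fst \<Gamma>. g ` X) v))"
  proof -
    \<comment> \<open>Both components of an arc are vertices, so the inner restrictions to
      \<open>fst \<Gamma>\<close> have no effect there; off the arcs both functions are
      \<open>undefined\<close>.\<close>
    have "(\<lambda>g. \<lambda>(X, Y) \<in> q_arcs \<Gamma>. (g ` X, g ` Y))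
        = (\<lambda>g. \<lambda>(u, v) \<in> q_arcs \<Gamma>. ((\<lambda>X \<in> fst \<Gamma>. g ` X) u, (\<lambda>X \<in> fst \<Gamma>. g ` X) v))"
      by (auto simp: fun_eq_iff q_arcs_def)
    with trans show ?thesis
      by (rule back_subst[where P = "transitive_action ?H (q_arcs \<Gamma>)"])
  qed
  moreover have "(\<lambda>g. \<lambda>X \<in> fst \<Gamma>. g ` X) ` carrier ?H
      \<subseteq> graph_automorphisms (classical_counterpart \<Gamma>)"
    using sub graph_automorphism_classical_counterpart[OF assms(1)] by auto
  moreover have "fst (classical_counterpart \<Gamma>) = fst \<Gamma>"
    by (simp add: classical_counterpart_def)
  ultimately show ?thesis
    unfolding symmetric_graph_def arcs_classical_counterpart
    using simple_graph_classical_counterpart[OF assms(1)] by metis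
qed

end
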